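(* Assume $\sigma_k>\sigma_{k+1}$. As a function of $r\ge0$, $\bar\alpha_k(r)$ is non-increasing and convex, and for all $r\ge0$ it satisfies $$\frac1{1+r}\bar\alpha_k(0)\le\bar\alpha_k(r)\le\frac1{1+r}\bar\alpha_k(0)+\frac r{1+r}\bar\alpha_k(\infty),$$ where $\bar\alpha_k(\infty)=\lim_{r\to+\infty}\bar\alpha_k(r)$; moreover $\bar\alpha_k(0)=\alpha_k$.
   Context: Let $\mathcal X=\{1,\dots,|\mathcal X|\}$ and $\mathcal Y=\{1,\dots,|\mathcal Y|\}$ be finite alphabets and $P_{XY}$ a joint probability distribution on $\mathcal X\times\mathcal Y$ whose marginals satisfy $P_X(x)>0$, $P_Y(y)>0$ for all $x,y$. Let $d=|\mathcal X|$. The matrix $\tilde{\mathbf B}\in\mathbb R^{|\mathcal Y|\times|\mathcal X|}$ has entries $\tilde B(y,x)=\frac{P_{XY}(x,y)-P_X(x)P_Y(y)}{\sqrt{P_X(x)P_Y(y)}}$. Let $\sigma_1\ge\dots\ge\sigma_d\ge0$ be its singular values ($\sigma_i=0$ for $i>|\mathcal Y|$) and $\boldsymbol\phi_1,\dots,\boldsymbol\phi_d\in\mathbb R^d$ corresponding orthonormal right singular vectors; $k\in\{1,\dots,d-1\}$. Let $\mathbf L$ be the $(|\mathcal X||\mathcal Y|)\times(|\mathcal X||\mathcal Y|)$ matrix whose entry in row $(x-1)|\mathcal Y|+y$ and column $(x'-1)|\mathcal Y|+y'$ is $$\sqrt{\frac{P_{XY}(x',y')}{P_X(x)P_Y(y)}}\left[\delta_{xx'}\delta_{yy'}-\frac12\left(\frac{\delta_{xx'}}{P_X(x)}+\frac{\delta_{yy'}}{P_Y(y)}\right)\left(P_{XY}(x,y)+P_X(x)P_Y(y)\right)\right].$$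 Let $\boldsymbol\theta_{ij}=\boldsymbol\phi_j\otimes(\tilde{\mathbf B}\boldsymbol\phi_i)+\boldsymbol\phi_i\otimes(\tilde{\mathbf B}\boldsymbol\phi_j)$ (Kronecker products) and $\mathbf G_k=\mathbf L^{\mathrm T}\left(\sum_{i=1}^k\sum_{j=k+1}^d\frac{\boldsymbol\theta_{ij}\boldsymbol\theta_{ij}^{\mathrm T}}{\sigma_i^2-\sigma_j^2}\right)\mathbf L$; $\alpha_k$ is the spectral norm of $\mathbf G_k$. For $r\ge0$ let $\bar{\mathbf L}(r)$ be the $(|\mathcal X||\mathcal Y|)\times[|\mathcal X|(|\mathcal Y|+1)]$ matrix whose entry in row $(x-1)|\mathcal Y|+y$ and column $(x'-1)|\mathcal Y|+y'$ is $\delta_{xx'}\delta_{yy'}-\frac r{1+r}\sqrt{P_{Y|X}(y|x)P_{Y|X}(y'|x')}\,\delta_{xx'}$, and whose entry in row $(x-1)|\mathcal Y|+y$ and column $|\mathcal X||\mathcal Y|+x'$ is $\frac{\sqrt r}{1+r}\sqrt{P_{Y|X}(y|x)}\,\delta_{xx'}$. Then $\bar\alpha_k(r)$ is the spectral norm of $\bar{\mathbf L}(r)^{\mathrm T}\mathbf G_k\bar{\mathbf L}(r)$. *)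

theory Defs
  imports "HOL-Probability.Probability"
begin

text \<open>
  The alphabets are finite types \<open>'x\<close> and \<open>'y\<close>. Vectors of length
  \<open>CARD('x) * CARD('y)\<close> are indexed by pairs \<open>(x, y)\<close>, in place of the flattened
  (1-based) index \<open>(x - 1) * CARD('y) + y\<close>; in the extended index type
  \<open>('x \<times> 'y) + 'x\<close>, \<open>Inl (x, y)\<close> is that index and
  \<open>Inr x\<close> stands for \<open>CARD('x) * CARD('y) + x\<close>.
\<close>

definition kdelta :: "'a \<Rightarrow> 'a \<Rightarrow> real" where
  "kdelta a b = (if a = b then 1 else 0)"

definition kron_vec :: "real^'m \<Rightarrow> real^'n \<Rightarrow> real^('m::finite \<times> 'n::finite)" where
  "kron_vec u v = (\<chi> p. u $ fst p * v $ snd p)"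

definition outer_prod :: "real^'m \<Rightarrow> real^'n \<Rightarrow> real^'n^'m" where
  "outer_prod u v = (\<chi> i j. u $ i * v $ j)"

definition spectral_norm :: "real^'n^'m \<Rightarrow> real" where
  "spectral_norm A = onorm (\<lambda>v. A *v v)"

definition orthonormal_family :: "(nat \<Rightarrow> real^'n) \<Rightarrow> nat set \<Rightarrow> bool" where
  "orthonormal_family v I \<longleftrightarrow> (\<forall>i\<in>I. \<forall>j\<in>I. v i \<bullet> v j = kdelta i j)"

text \<open>
  Singular value decomposition. There are as many singular values as columns: the usual
  \<open>min CARD('m) CARD('n)\<close> ones are padded by zeros. Only the values of \<open>\<sigma>\<close> and
  \<open>\<phi>\<close> at \<open>1, \<dots>, CARD('n)\<close> matter.
\<close>

definition right_singular_system ::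
    "real^'n^'m \<Rightarrow> (nat \<Rightarrow> real) \<Rightarrow> (nat \<Rightarrow> real^'n) \<Rightarrow> bool" where
  "right_singular_system A \<sigma> \<phi> \<longleftrightarrow>
     antimono_on {1..CARD('n)} \<sigma> \<and>
     (\<forall>i\<in>{1..CARD('n)}. 0 \<le> \<sigma> i) \<and>
     (\<forall>i\<in>{1..CARD('n)}. CARD('m) < i \<longrightarrow> \<sigma> i = 0) \<and>
     orthonormal_family \<phi> {1..CARD('n)} \<and>
     (\<exists>\<psi> :: nat \<Rightarrow> real^'m.
        orthonormal_family \<psi> {1..min CARD('m) CARD('n)} \<and>
        A = (\<Sum>i = 1..min CARD('m) CARD('n). \<sigma> i *\<^sub>R outer_prod (\<psi> i) (\<phi> i)))"

definition PX :: "('x \<times> 'y) pmf \<Rightarrow> 'x \<Rightarrow> real" where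
  "PX P x = pmf (map_pmf fst P) x"

definition PY :: "('x \<times> 'y) pmf \<Rightarrow> 'y \<Rightarrow> real" where
  "PY P y = pmf (map_pmf snd P) y"

definition PY_given_X :: "('x \<times> 'y) pmf \<Rightarrow> 'y \<Rightarrow> 'x \<Rightarrow> real" where
  "PY_given_X P y x = pmf P (x, y) / PX P x"

definition B_mat :: "('x::finite \<times> 'y::finite) pmf \<Rightarrow> real^'x^'y" where
  "B_mat P = (\<chi> y x. (pmf P (x, y) - PX P x * PY P y) / sqrt (PX P x * PY P y))"

definition L_mat :: "('x::finite \<times> 'y::finite) pmf \<Rightarrow> real^('x \<times> 'y)^('x \<times> 'y)" where
  "L_mat P = (\<chi> p q. case (p, q) of ((x, y), (x', y')) \<Rightarrow>
     sqrt (pmf P (x', y') / (PX P x * PY P y)) *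
     (kdelta x x' * kdelta y y' -
      1 / 2 * (kdelta x x' / PX P x + kdelta y y' / PY P y) *
        (pmf P (x, y) + PX P x * PY P y)))"

definition theta_vec ::
    "('x::finite \<times> 'y::finite) pmf \<Rightarrow> (nat \<Rightarrow> real^'x) \<Rightarrow> nat \<Rightarrow> nat \<Rightarrow> real^('x \<times> 'y)" where
  "theta_vec P \<phi> i j =
     kron_vec (\<phi> j) (B_mat P *v \<phi> i) + kron_vec (\<phi> i) (B_mat P *v \<phi> j)"

definition G_mat ::
    "('x::finite \<times> 'y::finite) pmf \<Rightarrow> (nat \<Rightarrow> real) \<Rightarrow> (nat \<Rightarrow> real^'x) \<Rightarrow> nat
     \<Rightarrow> real^('x \<times> 'y)^('x \<times> 'y)" where
  "G_mat P \<sigma> \<phi> k =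
     transpose (L_mat P) **
     (\<Sum>i = 1..k. \<Sum>j = k + 1..CARD('x).
        (1 / ((\<sigma> i)\<^sup>2 - (\<sigma> j)\<^sup>2)) *\<^sub>R outer_prod (theta_vec P \<phi> i j) (theta_vec P \<phi> i j)) **
     L_mat P"

definition alpha ::
    "('x::finite \<times> 'y::finite) pmf \<Rightarrow> (nat \<Rightarrow> real) \<Rightarrow> (nat \<Rightarrow> real^'x) \<Rightarrow> nat \<Rightarrow> real" where
  "alpha P \<sigma> \<phi> k = spectral_norm (G_mat P \<sigma> \<phi> k)"

definition L_bar ::
    "('x::finite \<times> 'y::finite) pmf \<Rightarrow> real \<Rightarrow> real^(('x \<times> 'y) + 'x)^('x \<times> 'y)" where
  "L_bar P r = (\<chi> p c. case p of (x, y) \<Rightarrow>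
     (case c of
        Inl (x', y') \<Rightarrow> kdelta x x' * kdelta y y' -
          r / (1 + r) * sqrt (PY_given_X P y x * PY_given_X P y' x') * kdelta x x'
      | Inr x' \<Rightarrow> sqrt r / (1 + r) * sqrt (PY_given_X P y x) * kdelta x x'))"

definition alpha_bar ::
    "('x::finite \<times> 'y::finite) pmf \<Rightarrow> (nat \<Rightarrow> real) \<Rightarrow> (nat \<Rightarrow> real^'x) \<Rightarrow> nat \<Rightarrow> real
     \<Rightarrow> real" where
  "alpha_bar P \<sigma> \<phi> k r =
     spectral_norm (transpose (L_bar P r) ** G_mat P \<sigma> \<phi> k ** L_bar P r)"

end

theory Submission
  imports Defs
begin

text \<open>
  Since \<open>\<sigma>\<close> is non-increasing and non-negative, \<open>G_mat\<close> is a Gram matrix \<open>N\<^sup>T N\<close>, and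
  \<open>alpha_bar\<close> at \<open>r\<close> is the squared norm of \<open>L_bar\<^sup>T N\<^sup>T\<close>. Since
  \<open>L_bar L_bar\<^sup>T = I - r / (1 + r) T T\<^sup>T\<close> for an isometry \<open>T\<close>, this is the supremum over
  unit vectors \<open>u\<close> of \<open>a u + b u / (1 + r)\<close> with \<open>a, b \<ge> 0\<close>. Every claim holds for these
  functions of \<open>r\<close> individually and survives the supremum; \<open>alpha_inf\<close> is the supremum
  of \<open>a\<close>.
\<close>

section \<open>Spectral norms, transposes and Gram matrices\<close>

lemma norm_mult_vec_le_spectral_norm: "norm (A *v u) \<le> spectral_norm A * norm u"
  unfolding spectral_norm_def by (rule onorm) (rule matrix_vector_mul_bounded_linear)

lemma spectral_norm_nonneg: "0 \<le> spectral_norm A"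
  unfolding spectral_norm_def by (rule onorm_pos_le) (rule matrix_vector_mul_bounded_linear)

lemma spectral_norm_le: "(\<And>u. norm (A *v u) \<le> c * norm u) \<Longrightarrow> spectral_norm A \<le> c"
  unfolding spectral_norm_def by (rule onorm_le)

lemma norm_mult_vec_sq_le: "(norm (A *v u))\<^sup>2 \<le> (spectral_norm A)\<^sup>2 * (norm u)\<^sup>2"
  using power_mono[OF norm_mult_vec_le_spectral_norm norm_ge_zero, of A u 2]
  by (simp add: power_mult_distrib)

text \<open>With \<open>norm_mult_vec_sq_le\<close>, this makes the squared spectral norm the least
  non-negative constant \<open>c\<close> dominating the quadratic form of \<open>A\<close>. The
  supremum over \<open>u\<close> is handled through this property below.\<close>

lemma spectral_norm_sq_le:
  assumes "0 \<le> c" and "\<And>u. (norm (A *v u))\<^sup>2 \<le> c * (norm u)\<^sup>2"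
  shows "(spectral_norm A)\<^sup>2 \<le> c"
proof -
  have "norm (A *v u) \<le> sqrt c * norm u" for u
    using real_sqrt_le_mono[OF assms(2)[of u]] by (simp add: real_sqrt_mult)
  then have "spectral_norm A \<le> sqrt c"
    by (rule spectral_norm_le)
  from power_mono[OF this spectral_norm_nonneg, of 2] show ?thesis
    using assms(1) by simp
qed

lemma transpose_mult_vec_inner:
  fixes A :: "real^'n^'m"
  shows "(transpose A *v u) \<bullet> v = u \<bullet> (A *v v)"
  by (simp add: dot_lmul_matrix)

text \<open>This rule rewrites \<open>transpose A *v u\<close> to \<open>u v* A\<close>. The adjoint
  identity just proved relies on it; from here on the transposed form is kept.\<close>

declare transpose_matrix_vector [simp del]

text \<open>Moving \<open>A\<close> across the inner product and applying Cauchy-Schwarz bounds the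
  square of \<open>norm ?v\<close> by a multiple of \<open>norm ?v\<close>, and one factor cancels.
  Since transposition is an involution, the inequality yields equality.\<close>

lemma spectral_norm_transpose_le:
  fixes A :: "real^'n^'m"
  shows "spectral_norm (transpose A) \<le> spectral_norm A"
proof (rule spectral_norm_le)
  fix u :: "real^'m"
  let ?v = "transpose A *v u"
  have "norm ?v * norm ?v = u \<bullet> (A *v ?v)"
    using transpose_mult_vec_inner[of A u ?v] by (simp add: dot_square_norm power2_eq_square)
  also have "\<dots> \<le> norm u * (spectral_norm A * norm ?v)"
    by (rule order_trans[OF norm_cauchy_schwarz])
      (simp add: mult_left_mono norm_mult_vec_le_spectral_norm)
  finally have "norm ?v * norm ?v \<le> (spectral_norm A * norm u) * norm ?v"
    by (simp add: mult_ac)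
  then show "norm ?v \<le> spectral_norm A * norm u"
    using spectral_norm_nonneg[of A] by (cases "norm ?v = 0") auto
qed

lemma spectral_norm_transpose:
  fixes A :: "real^'n^'m"
  shows "spectral_norm (transpose A) = spectral_norm A"
  using spectral_norm_transpose_le[of A] spectral_norm_transpose_le[of "transpose A"] by simp

lemma spectral_norm_gram:
  fixes A :: "real^'n^'m"
  shows "spectral_norm (transpose A ** A) = (spectral_norm A)\<^sup>2"
proof (rule antisym)
  show "spectral_norm (transpose A ** A) \<le> (spectral_norm A)\<^sup>2"
  proof (rule spectral_norm_le)
    fix u :: "real^'n"
    have "norm (transpose A *v (A *v u)) \<le> spectral_norm A * norm (A *v u)"
      using norm_mult_vec_le_spectral_norm[of "transpose A" "A *v u"]
      by (simp add: spectral_norm_transpose)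
    also have "\<dots> \<le> spectral_norm A * (spectral_norm A * norm u)"
      by (intro mult_left_mono norm_mult_vec_le_spectral_norm spectral_norm_nonneg)
    finally show "norm ((transpose A ** A) *v u) \<le> (spectral_norm A)\<^sup>2 * norm u"
      by (simp add: matrix_vector_mul_assoc power2_eq_square mult_ac)
  qed
  show "(spectral_norm A)\<^sup>2 \<le> spectral_norm (transpose A ** A)"
  proof (rule spectral_norm_sq_le[OF spectral_norm_nonneg])
    fix u :: "real^'n"
    have "(norm (A *v u))\<^sup>2 = ((transpose A ** A) *v u) \<bullet> u"
      using transpose_mult_vec_inner[of A "A *v u" u]
      by (simp add: dot_square_norm matrix_vector_mul_assoc)
    also have "\<dots> \<le> norm ((transpose A ** A) *v u) * norm u"
      by (rule norm_cauchy_schwarz)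
    also have "\<dots> \<le> (spectral_norm (transpose A ** A) * norm u) * norm u"
      by (intro mult_right_mono norm_mult_vec_le_spectral_norm) simp
    finally show "(norm (A *v u))\<^sup>2 \<le> spectral_norm (transpose A ** A) * (norm u)\<^sup>2"
      by (simp add: power2_eq_square mult_ac)
  qed
qed

section \<open>Suprema of the functions a + b / (1 + r)\<close>

text \<open>The facts \<open>fle\<close> and \<open>fge\<close> say that \<open>f r\<close> is the
  least non-negative constant dominating the quadratic form at \<open>r\<close>. Each claim thus
  becomes an inequality for one fixed \<open>u\<close>.\<close>

lemma spectral_norm_sq_family:
  fixes A :: "real^'n^'a" and B :: "real^'n^'b" and C :: "real \<Rightarrow> real^'n^'c"
  defines "f \<equiv> \<lambda>r. (spectral_norm (C r))\<^sup>2"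
  assumes C: "\<And>r u. 0 \<le> r \<Longrightarrow>
    (norm (C r *v u))\<^sup>2 = (norm (A *v u))\<^sup>2 + (norm (B *v u))\<^sup>2 / (1 + r)"
  shows "antimono_on {0..} f" and "convex_on {0..} f"
    and "(f \<longlongrightarrow> (spectral_norm A)\<^sup>2) at_top"
    and "\<And>r. 0 \<le> r \<Longrightarrow> 1 / (1 + r) * f 0 \<le> f r"
    and "\<And>r. 0 \<le> r \<Longrightarrow> f r \<le> 1 / (1 + r) * f 0 + r / (1 + r) * (spectral_norm A)\<^sup>2"
proof -
  have f0: "0 \<le> f r" for r
    by (simp add: f_def)
  have fle: "f r \<le> c" if "0 \<le> r" "0 \<le> c"
    "\<And>u. (norm (A *v u))\<^sup>2 + (norm (B *v u))\<^sup>2 / (1 + r) \<le> c * (norm u)\<^sup>2" for r c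
    unfolding f_def using that by (intro spectral_norm_sq_le) (auto simp: C)
  have fge: "(norm (A *v u))\<^sup>2 + (norm (B *v u))\<^sup>2 / (1 + r) \<le> f r * (norm u)\<^sup>2"
    if "0 \<le> r" for r u
    unfolding f_def using norm_mult_vec_sq_le[of "C r" u] that by (simp add: C)
  show "antimono_on {0..} f"
  proof (rule monotone_onI)
    fix r s :: real assume rs: "r \<in> {0..}" "s \<in> {0..}" "r \<le> s"
    show "f s \<le> f r"
    proof (rule fle)
      fix u
      have "(norm (B *v u))\<^sup>2 / (1 + s) \<le> (norm (B *v u))\<^sup>2 / (1 + r)"
        using rs by (intro divide_left_mono) auto
      with fge[of r u] rs
      show "(norm (A *v u))\<^sup>2 + (norm (B *v u))\<^sup>2 / (1 + s) \<le> f r * (norm u)\<^sup>2"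
        by simp
    qed (use rs f0 in auto)
  qed
  show "convex_on {0..} f"
  proof (rule convex_onI)
    fix t x y :: real assume t: "0 < t" "t < 1" and xy: "x \<in> {0..}" "y \<in> {0..}"
    let ?z = "(1 - t) *\<^sub>R x + t *\<^sub>R y"
    have z: "0 \<le> ?z" using t xy by simp
    \<comment> \<open>The map 1 / (1 + r) is convex because the inverse is convex on the positive
      reals.\<close>
    have conv: "1 / (1 + ?z) \<le> (1 - t) * (1 / (1 + x)) + t * (1 / (1 + y))"
    proof -
      have "1 + ?z = (1 - t) *\<^sub>R (1 + x) + t *\<^sub>R (1 + y)"
        by (simp add: algebra_simps)
      then show ?thesis
        using convex_onD[OF convex_on_inverse[of "{0<..}"], of t "1 + x" "1 + y"] t xy
        by (simp add: inverse_eq_divide)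
    qed
    show "f ?z \<le> (1 - t) * f x + t * f y"
    proof (rule fle[OF z])
      fix u
      let ?a = "(norm (A *v u))\<^sup>2" and ?b = "(norm (B *v u))\<^sup>2"
      have "?a + ?b / (1 + ?z) \<le> ?a + ?b * ((1 - t) * (1 / (1 + x)) + t * (1 / (1 + y)))"
        using mult_left_mono[OF conv, of ?b] by simp
      also have "\<dots> = (1 - t) * (?a + ?b / (1 + x)) + t * (?a + ?b / (1 + y))"
        by (simp add: algebra_simps)
      also have "\<dots> \<le> (1 - t) * (f x * (norm u)\<^sup>2) + t * (f y * (norm u)\<^sup>2)"
        using t xy by (intro add_mono mult_left_mono fge) auto
      finally show "?a + ?b / (1 + ?z) \<le> ((1 - t) * f x + t * f y) * (norm u)\<^sup>2"
        by (simp add: algebra_simps)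
    qed (use t f0 in auto)
  qed simp
  show lower: "1 / (1 + r) * f 0 \<le> f r" if r: "0 \<le> r" for r
  proof -
    have "f 0 \<le> (1 + r) * f r"
    proof (rule fle)
      fix u
      let ?a = "(norm (A *v u))\<^sup>2" and ?b = "(norm (B *v u))\<^sup>2"
      \<comment> \<open>Multiplying by 1 + r keeps \<open>?b\<close> and can only enlarge
        \<open>?a\<close>. The denominator 1 + 0 matches the form of \<open>fle\<close> at
        zero.\<close>
      have "?a + ?b / (1 + 0) \<le> (1 + r) * (?a + ?b / (1 + r))"
        using r by (simp add: field_simps)
      also have "\<dots> \<le> (1 + r) * (f r * (norm u)\<^sup>2)"
        using r by (intro mult_left_mono fge) auto
      finally show "?a + ?b / (1 + 0) \<le> (1 + r) * f r * (norm u)\<^sup>2"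
        by (simp add: mult_ac)
    qed (use r f0 in auto)
    then show ?thesis using r by (simp add: field_simps)
  qed
  show upper: "f r \<le> 1 / (1 + r) * f 0 + r / (1 + r) * (spectral_norm A)\<^sup>2"
    if r: "0 \<le> r" for r
  proof (rule fle[OF r])
    fix u
    let ?a = "(norm (A *v u))\<^sup>2" and ?b = "(norm (B *v u))\<^sup>2"
    \<comment> \<open>An exact convex combination of the value \<open>?a + ?b\<close> at r = 0 and
      the limiting value \<open>?a\<close>; bounding the two terms separately gives the upper
      estimate.\<close>
    have "?a + ?b / (1 + r) = 1 / (1 + r) * (?a + ?b / (1 + 0)) + r / (1 + r) * ?a"
      using r by (simp add: divide_simps) (simp add: algebra_simps)
    also have "\<dots> \<le> 1 / (1 + r) * (f 0 * (norm u)\<^sup>2)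
        + r / (1 + r) * ((spectral_norm A)\<^sup>2 * (norm u)\<^sup>2)"
      using r by (intro add_mono mult_left_mono fge norm_mult_vec_sq_le) auto
    finally show "?a + ?b / (1 + r)
        \<le> (1 / (1 + r) * f 0 + r / (1 + r) * (spectral_norm A)\<^sup>2) * (norm u)\<^sup>2"
      by (simp add: algebra_simps)
  qed (use r f0 in auto)
  have A_le: "(spectral_norm A)\<^sup>2 \<le> f r" if r: "0 \<le> r" for r
  proof (rule spectral_norm_sq_le[OF f0])
    fix u
    have "0 \<le> (norm (B *v u))\<^sup>2 / (1 + r)" using r by simp
    with fge[OF r, of u] show "(norm (A *v u))\<^sup>2 \<le> f r * (norm u)\<^sup>2" by linarith
  qed
  \<comment> \<open>The upper estimate just proved tends to the lower bound \<open>A_le\<close>, so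
    it also yields the limit.\<close>
  show "(f \<longlongrightarrow> (spectral_norm A)\<^sup>2) at_top"
  proof (rule tendsto_sandwich)
    show "\<forall>\<^sub>F r in at_top. (spectral_norm A)\<^sup>2 \<le> f r"
      using eventually_ge_at_top[of 0] by eventually_elim (rule A_le)
    show "\<forall>\<^sub>F r in at_top. f r \<le> 1 / (1 + r) * f 0 + r / (1 + r) * (spectral_norm A)\<^sup>2"
      using eventually_ge_at_top[of 0] by eventually_elim (rule upper)
    have "((\<lambda>r::real. 1 / (1 + r)) \<longlongrightarrow> 0) at_top" "((\<lambda>r::real. r / (1 + r)) \<longlongrightarrow> 1) at_top"
      by real_asymp+
    from tendsto_add[OF tendsto_mult_right[OF this(1)] tendsto_mult_right[OF this(2)]]
    show "((\<lambda>r. 1 / (1 + r) * f 0 + r / (1 + r) * (spectral_norm A)\<^sup>2)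
        \<longlongrightarrow> (spectral_norm A)\<^sup>2) at_top"
      by fastforce
  qed simp
qed

section \<open>The isometry built from the conditional distributions, and
  \<open>L_bar\<close>\<close>

text \<open>Writing T for this matrix, \<open>L_bar P r\<close> is the block row consisting of I - r
  / (1 + r) T T^T and sqrt r / (1 + r) T.\<close>

definition cond_sqrt :: "('x::finite \<times> 'y::finite) pmf \<Rightarrow> real^'x^('x \<times> 'y)" where
  "cond_sqrt P = (\<chi> p x. sqrt (PY_given_X P (snd p) x) * kdelta (fst p) x)"

lemma sum_UNIV_prod:
  fixes f :: "'a::finite \<times> 'b::finite \<Rightarrow> 'c::comm_monoid_add"
  shows "(\<Sum>p\<in>UNIV. f p) = (\<Sum>a\<in>UNIV. \<Sum>b\<in>UNIV. f (a, b))"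
  by (simp add: sum.cartesian_product)

lemma sum_kdelta_fst:
  fixes f :: "'a::finite \<times> 'b::finite \<Rightarrow> real"
  shows "(\<Sum>p\<in>UNIV. f p * kdelta (fst p) a) = (\<Sum>b\<in>UNIV. f (a, b))"
  by (subst sum_UNIV_prod, subst sum.swap)
    (simp add: kdelta_def if_distrib[where f = "(*) _"] cong: if_cong)

lemma sum_kdelta_pair:
  fixes f :: "'a::finite \<times> 'b::finite \<Rightarrow> real"
  shows "(\<Sum>p\<in>UNIV. f p * (kdelta (fst p) a * kdelta (snd p) b)) = f (a, b)"
  using sum_kdelta_fst[of "\<lambda>p. f p * kdelta (snd p) b" a]
  by (simp add: mult_ac) (simp add: kdelta_def if_distrib[where f = "\<lambda>c. c * _"] cong: if_cong)

lemma cond_sqrt_mult_vec: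
  "cond_sqrt P *v t = (\<chi> p. sqrt (PY_given_X P (snd p) (fst p)) * t $ fst p)"
  by (simp add: vec_eq_iff cond_sqrt_def matrix_vector_mult_def kdelta_def
      if_distrib[where f = "\<lambda>c. c * _"] if_distrib[where f = "(*) _"] cong: if_cong)

lemma transpose_cond_sqrt_mult_vec:
  fixes P :: "('x::finite \<times> 'y::finite) pmf"
  shows "transpose (cond_sqrt P) *v w = (\<chi> x. \<Sum>y\<in>UNIV. sqrt (PY_given_X P y x) * w $ (x, y))"
  using sum_kdelta_fst[of "\<lambda>p. sqrt (PY_given_X P (snd p) x) * w $ p" x for x]
  by (simp add: vec_eq_iff matrix_vector_mult_def transpose_def cond_sqrt_def mult_ac)

lemma sum_PY_given_X:
  fixes P :: "('x::finite \<times> 'y::finite) pmf"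
  assumes "PX P x > 0"
  shows "(\<Sum>y\<in>UNIV. PY_given_X P y x) = 1"
proof -
  have "fst -` {x} = (\<lambda>y. (x, y)) ` (UNIV :: 'y set)"
    by auto
  then have "PX P x = (\<Sum>y\<in>UNIV. pmf P (x, y))"
    by (simp add: PX_def pmf_map measure_measure_pmf_finite sum.reindex inj_on_def)
  with assms show ?thesis
    by (simp add: PY_given_X_def sum_divide_distrib[symmetric])
qed

text \<open>The columns have disjoint supports, and each is a unit vector because a conditional
  distribution sums to one.\<close>

lemma cond_sqrt_isometry:
  fixes P :: "('x::finite \<times> 'y::finite) pmf"
  assumes "\<And>x. PX P x > 0"
  shows "transpose (cond_sqrt P) *v (cond_sqrt P *v t) = t"
proof -
  have "sqrt (PY_given_X P y x) * sqrt (PY_given_X P y x) = PY_given_X P y x" for x y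
    using assms[of x] by (simp add: PY_given_X_def)
  then show ?thesis
    by (simp add: transpose_cond_sqrt_mult_vec cond_sqrt_mult_vec vec_eq_iff
        mult.assoc[symmetric] sum_distrib_right[symmetric] sum_PY_given_X assms)
qed

lemma norm_sq_sum_vec:
  fixes v :: "real^('a::finite + 'b::finite)"
  shows "(norm v)\<^sup>2 = (norm (\<chi> a. v $ Inl a))\<^sup>2 + (norm (\<chi> b. v $ Inr b))\<^sup>2"
  by (simp add: power2_norm_eq_inner inner_vec_def UNIV_Plus_UNIV[symmetric] sum.Plus
      del: UNIV_Plus_UNIV)

text \<open>At r = 0 the matrix is the identity next to a zero block. This is the source of the
  equality of \<open>alpha_bar\<close> at 0 with \<open>alpha\<close>.\<close>

lemma norm_transpose_L_bar_0:
  fixes P :: "('x::finite \<times> 'y::finite) pmf"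
  shows "norm (transpose (L_bar P 0) *v w) = norm w"
proof -
  let ?v = "transpose (L_bar P 0) *v w"
  have "?v $ Inl (x', y') = w $ (x', y')" for x' y'
    using sum_kdelta_pair[of "($) w" x' y']
    by (simp add: matrix_vector_mult_def transpose_def L_bar_def case_prod_unfold mult_ac)
  then have "(\<chi> p. ?v $ Inl p) = w"
    by (simp add: vec_eq_iff)
  moreover have "(\<chi> x. ?v $ Inr x) = 0"
    by (simp add: vec_eq_iff matrix_vector_mult_def transpose_def L_bar_def case_prod_unfold)
  ultimately have "(norm ?v)\<^sup>2 = (norm w)\<^sup>2"
    unfolding norm_sq_sum_vec[of ?v] by simp
  then show ?thesis by simp
qed

text \<open>For t = T^T w, the two blocks of the image are w - r / (1 + r) T t and sqrt r / (1 + r)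
  t. Since T is an isometry, the squared norm is |w|^2 - r / (1 + r) |t|^2, and |w|^2 - |t|^2 is the
  squared norm of the component of w orthogonal to the range of T.\<close>

lemma norm_transpose_L_bar:
  fixes P :: "('x::finite \<times> 'y::finite) pmf"
  assumes PX: "\<And>x. PX P x > 0" and r: "0 \<le> r"
  defines "T \<equiv> cond_sqrt P"
  shows "(norm (transpose (L_bar P r) *v w))\<^sup>2
    = (norm ((mat 1 - T ** transpose T) *v w))\<^sup>2 + (norm (transpose T *v w))\<^sup>2 / (1 + r)"
proof -
  let ?v = "transpose (L_bar P r) *v w"
  define t where "t = transpose T *v w"
  have t: "t $ x = (\<Sum>y\<in>UNIV. sqrt (PY_given_X P y x) * w $ (x, y))" for x
    by (simp add: t_def T_def transpose_cond_sqrt_mult_vec)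
  have Inl: "(\<chi> p. ?v $ Inl p) = w - (r / (1 + r)) *\<^sub>R (T *v t)"
  proof -
    have "?v $ Inl (x', y') = w $ (x', y') - r / (1 + r) * (sqrt (PY_given_X P y' x') * t $ x')"
      for x' y'
    proof -
      have "?v $ Inl (x', y') = (\<Sum>p\<in>UNIV. w $ p * (kdelta (fst p) x' * kdelta (snd p) y'))
        - (\<Sum>p\<in>UNIV. r / (1 + r) * sqrt (PY_given_X P (snd p) (fst p) * PY_given_X P y' x')
            * w $ p * kdelta (fst p) x')"
        by (simp add: matrix_vector_mult_def transpose_def L_bar_def case_prod_unfold
            sum_subtractf[symmetric] algebra_simps)
      then show ?thesis
        unfolding sum_kdelta_pair sum_kdelta_fst
        by (simp add: t sum_distrib_left real_sqrt_mult mult_ac)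
    qed
    then show ?thesis
      by (simp add: vec_eq_iff T_def cond_sqrt_mult_vec)
  qed
  have Inr: "(\<chi> x. ?v $ Inr x) = (sqrt r / (1 + r)) *\<^sub>R t"
  proof -
    have "?v $ Inr x' = sqrt r / (1 + r) * t $ x'" for x'
    proof -
      have "?v $ Inr x' = (\<Sum>p\<in>UNIV. sqrt r / (1 + r) * sqrt (PY_given_X P (snd p) (fst p))
            * w $ p * kdelta (fst p) x')"
        by (simp add: matrix_vector_mult_def transpose_def L_bar_def case_prod_unfold mult_ac)
      then show ?thesis
        unfolding sum_kdelta_fst by (simp add: t sum_distrib_left mult_ac)
    qed
    then show ?thesis
      by (simp add: vec_eq_iff)
  qed
  have TT: "(T *v t) \<bullet> (T *v t) = t \<bullet> t"
    using transpose_mult_vec_inner[of T "T *v t" t] cond_sqrt_isometry[OF PX, of t]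
    by (simp add: T_def)
  have wT: "w \<bullet> (T *v t) = t \<bullet> t"
    using transpose_mult_vec_inner[of T w t] by (simp add: t_def)
  \<comment> \<open>Used with c = r / (1 + r) for the first block and with c = 1 for the orthogonal
    component.\<close>
  have gen: "(norm (w - c *\<^sub>R (T *v t)))\<^sup>2 = w \<bullet> w - 2 * c * (t \<bullet> t) + c\<^sup>2 * (t \<bullet> t)" for c
    unfolding power2_norm_eq_inner using TT wT inner_commute[of "T *v t" w]
    by (simp add: inner_diff power2_eq_square algebra_simps)
  have "(norm ?v)\<^sup>2 = w \<bullet> w - 2 * (r / (1 + r)) * (t \<bullet> t) + (r / (1 + r))\<^sup>2 * (t \<bullet> t)
      + (sqrt r / (1 + r))\<^sup>2 * (t \<bullet> t)"
    unfolding norm_sq_sum_vec[of ?v] Inl Inr gen unfolding power2_norm_eq_inner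
    by (simp only: inner_scaleR_left inner_scaleR_right power2_eq_square mult.assoc)
  also have "\<dots> = w \<bullet> w - (t \<bullet> t) + (t \<bullet> t) / (1 + r)"
  proof -
    have "(sqrt r / (1 + r))\<^sup>2 = r / (1 + r)\<^sup>2"
      using r by (simp add: power_divide)
    moreover have "w \<bullet> w - 2 * (r / (1 + r)) * s + (r / (1 + r))\<^sup>2 * s + r / (1 + r)\<^sup>2 * s
        = w \<bullet> w - s + s / (1 + r)" for s
      using r by (simp add: divide_simps power2_eq_square) (simp add: algebra_simps)
    ultimately show ?thesis by simp
  qed
  also have "w \<bullet> w - (t \<bullet> t) = (norm (w - T *v t))\<^sup>2"
    using gen[of 1] by simp
  also have "w - T *v t = (mat 1 - T ** transpose T) *v w"
    by (simp add: t_def matrix_vector_mult_diff_rdistrib matrix_vector_mul_assoc)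
  finally show ?thesis
    by (simp add: t_def power2_norm_eq_inner)
qed

section \<open>Weighted sums of outer products as Gram matrices\<close>

lemma sum_outer_prod_gram:
  fixes v :: "'i::finite \<Rightarrow> real^'n"
  shows "(\<Sum>i\<in>UNIV. outer_prod (v i) (v i)) = transpose (\<chi> i. v i) ** (\<chi> i. v i)"
  by (simp add: vec_eq_iff outer_prod_def matrix_matrix_mult_def transpose_def)

text \<open>The rows of \<open>N\<close> are the vectors scaled by the square roots of their
  weights. Rows must be indexed by a type, so the index pairs are embedded in the full square grid,
  which is in bijection with \<open>'x \<times> 'x\<close>; the surplus rows are zero.\<close>

lemma sum_outer_prod_factor:
  fixes \<theta> :: "nat \<Rightarrow> nat \<Rightarrow> real^'n" and w :: "nat \<Rightarrow> nat \<Rightarrow> real"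
  assumes "k \<le> CARD('x::finite)"
    and w: "\<And>i j. i \<in> {1..k} \<Longrightarrow> j \<in> {k + 1..CARD('x::finite)} \<Longrightarrow> 0 \<le> w i j"
  obtains N :: "real^'n^('x::finite \<times> 'x)" where
    "(\<Sum>i = 1..k. \<Sum>j = k + 1..CARD('x::finite). w i j *\<^sub>R outer_prod (\<theta> i j) (\<theta> i j))
      = transpose N ** N"
proof -
  let ?I = "{1..k} \<times> {k + 1..CARD('x)}" and ?D = "{1..CARD('x)}"
  obtain h where "bij_betw h ?D (UNIV :: 'x set)"
    using ex_bij_betw_nat_finite_1[OF finite[of "UNIV :: 'x set"]] by auto
  then have h: "bij_betw (map_prod h h) (?D \<times> ?D) (UNIV :: ('x \<times> 'x) set)"
    using bij_betw_map_prod by (metis UNIV_Times_UNIV)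
  define u where "u q = (if q \<in> ?I then sqrt (w (fst q) (snd q)) *\<^sub>R \<theta> (fst q) (snd q) else 0)"
    for q
  define v where "v = u \<circ> inv_into (?D \<times> ?D) (map_prod h h)"
  have "(\<Sum>i = 1..k. \<Sum>j = k + 1..CARD('x). w i j *\<^sub>R outer_prod (\<theta> i j) (\<theta> i j))
      = (\<Sum>q\<in>?I. outer_prod (u q) (u q))"
    unfolding sum.cartesian_product
  proof (rule sum.cong)
    fix q assume q: "q \<in> ?I"
    then have "0 \<le> w (fst q) (snd q)" using w by auto
    then show "(case q of (i, j) \<Rightarrow> w i j *\<^sub>R outer_prod (\<theta> i j) (\<theta> i j)) = outer_prod (u q) (u q)"
      using q by (auto simp: u_def outer_prod_def vec_eq_iff)
  qed simp
  also have "\<dots> = (\<Sum>q\<in>?D \<times> ?D. outer_prod (u q) (u q))"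
    using assms(1) by (intro sum.mono_neutral_left) (auto simp: u_def outer_prod_def vec_eq_iff)
  also have "\<dots> = (\<Sum>p\<in>UNIV. outer_prod (v p) (v p))"
    unfolding sum.reindex_bij_betw[OF h, symmetric]
    by (rule sum.cong) (use h in \<open>auto simp: v_def bij_betw_def simp del: map_prod_simp\<close>)
  finally show ?thesis
    using that sum_outer_prod_gram by metis
qed

theorem proposition2:
  fixes P :: "('x::finite \<times> 'y::finite) pmf"
    and \<sigma> :: "nat \<Rightarrow> real"
    and \<phi> :: "nat \<Rightarrow> real^'x"
    and k :: nat
  assumes "\<And>x. PX P x > 0"
    and "\<And>y. PY P y > 0"
    and "right_singular_system (B_mat P) \<sigma> \<phi>"
    and "k \<in> {1..CARD('x) - 1}"
    and "\<sigma> k > \<sigma> (k + 1)"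
  shows "antimono_on {0..} (alpha_bar P \<sigma> \<phi> k) \<and>
    convex_on {0..} (alpha_bar P \<sigma> \<phi> k) \<and>
    (\<exists>alpha_inf.
      (alpha_bar P \<sigma> \<phi> k \<longlongrightarrow> alpha_inf) at_top \<and>
      (\<forall>r\<ge>0.
        1 / (1 + r) * alpha_bar P \<sigma> \<phi> k 0 \<le> alpha_bar P \<sigma> \<phi> k r \<and>
        alpha_bar P \<sigma> \<phi> k r
          \<le> 1 / (1 + r) * alpha_bar P \<sigma> \<phi> k 0 + r / (1 + r) * alpha_inf)) \<and>
    alpha_bar P \<sigma> \<phi> k 0 = alpha P \<sigma> \<phi> k"
proof -
  have k: "k \<le> CARD('x)" using assms(4) by auto
  \<comment> \<open>Here i <= k < j, so the ordering of the singular values gives the sign that the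
    square roots in the factor require.\<close>
  have "0 \<le> 1 / ((\<sigma> i)\<^sup>2 - (\<sigma> j)\<^sup>2)" if "i \<in> {1..k}" "j \<in> {k + 1..CARD('x)}" for i j
  proof -
    have "i \<in> {1..CARD('x)}" "j \<in> {1..CARD('x)}" "i \<le> j" using that k by auto
    then have "0 \<le> \<sigma> j" "\<sigma> j \<le> \<sigma> i"
      using assms(3) unfolding right_singular_system_def by (auto elim!: monotone_onD)
    then show ?thesis by (simp add: power_mono)
  qed
  from sum_outer_prod_factor[where w = "\<lambda>i j. 1 / ((\<sigma> i)\<^sup>2 - (\<sigma> j)\<^sup>2)", OF k this]
  obtain M :: "real^('x \<times> 'y)^('x \<times> 'x)" where
    M: "(\<Sum>i = 1..k. \<Sum>j = k + 1..CARD('x). (1 / ((\<sigma> i)\<^sup>2 - (\<sigma> j)\<^sup>2)) *\<^sub>R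
        outer_prod (theta_vec P \<phi> i j) (theta_vec P \<phi> i j)) = transpose M ** M"
    by blast
  define N where "N = M ** L_mat P"
  have G: "G_mat P \<sigma> \<phi> k = transpose N ** N"
    unfolding G_mat_def M by (simp add: N_def matrix_transpose_mul matrix_mul_assoc)
  \<comment> \<open>This is the transpose of \<open>N ** L_bar P r\<close>, which has the same norm.
    In this order \<open>transpose (L_bar P r)\<close> acts on the vector
    \<open>transpose N *v u\<close>, so \<open>norm_transpose_L_bar\<close> applies.\<close>
  define C where "C r = transpose (L_bar P r) ** transpose N" for r
  have alpha_bar: "alpha_bar P \<sigma> \<phi> k = (\<lambda>r. (spectral_norm (C r))\<^sup>2)"
  proof
    fix r
    have "transpose (L_bar P r) ** G_mat P \<sigma> \<phi> k ** L_bar P r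
        = transpose (N ** L_bar P r) ** (N ** L_bar P r)"
      by (simp add: G matrix_transpose_mul matrix_mul_assoc)
    then show "alpha_bar P \<sigma> \<phi> k r = (spectral_norm (C r))\<^sup>2"
      unfolding alpha_bar_def C_def matrix_transpose_mul[symmetric]
      by (simp only: spectral_norm_gram spectral_norm_transpose)
  qed
  let ?T = "cond_sqrt P"
  \<comment> \<open>The first factor projects onto the orthogonal complement of the range of
    \<open>?T\<close>; the squared norm of \<open>?A\<close> is the limit at infinity.\<close>
  let ?A = "(mat 1 - ?T ** transpose ?T) ** transpose N"
  have C: "(norm (C r *v u))\<^sup>2
      = (norm (?A *v u))\<^sup>2 + (norm ((transpose ?T ** transpose N) *v u))\<^sup>2 / (1 + r)"
    if "0 \<le> r" for r u
    unfolding C_def matrix_vector_mul_assoc[symmetric]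
    by (rule norm_transpose_L_bar[OF assms(1) that])
  have "norm (C 0 *v u) = norm (transpose N *v u)" for u
    unfolding C_def matrix_vector_mul_assoc[symmetric] by (rule norm_transpose_L_bar_0)
  \<comment> \<open>\<open>C 0\<close> and \<open>transpose N\<close> have different numbers of
    rows, but the operator norm depends only on the norms of the images.\<close>
  then have "spectral_norm (C 0) = spectral_norm (transpose N)"
    by (simp add: spectral_norm_def onorm_def)
  then have at_0: "alpha_bar P \<sigma> \<phi> k 0 = alpha P \<sigma> \<phi> k"
    unfolding alpha_bar alpha_def G by (simp add: spectral_norm_gram spectral_norm_transpose)
  note family = spectral_norm_sq_family[of C, OF C, folded fun_cong[OF alpha_bar] alpha_bar]
  show ?thesis
    using family at_0 by (intro conjI exI[of _ "(spectral_norm ?A)\<^sup>2"]) simp_all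
qed

end
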